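(* If $\Psi=\Psi(s,t)$ is a solution of the Betchov-Da Rios equation $\Psi_t=\Psi_s\times\Psi_{ss}\times\Psi_{sss}$ in $E^4$ (with unit speed $s$-parameter curves), then, according to the parallel transport frame field, the Gaussian curvature of the soliton surface $S:\Psi=\Psi(s,t)$ is $$K=\frac{\mathcal{A}\mathcal{W}^2-Q^2\mathcal{C}^2}{\mathcal{W}^4}.$$
   Context: Setting. $E^4$ is $\mathbb{R}^4$ with its standard inner product $\langle\cdot,\cdot\rangle$ and orientation; the ternary vector product $x\times y\times z$ is the formal determinant of the $4\times4$ matrix whose first row is the standard basis $(e_1,e_2,e_3,e_4)$ and whose remaining rows are $x,y,z$. Subscripts $s,t$ denote partial derivatives. $\Psi=\Psi(s,t)$ is a smooth map from a product of two open intervals to $E^4$ whose $s$-parameter curves $s\mapsto\Psi(s,t)$ are unit speed for all $t$. A parallel transport frame field is a smooth positively oriented orthonormal frame $\{\mathcal{T},\mathcal{P}_1,\mathcal{P}_2,\mathcal{P}_3\}$ along $\Psi$ with $\mathcal{T}=\Psi_s$, $\mathcal{T}_s=k_1\mathcal{P}_1+k_2\mathcal{P}_2+k_3\mathcal{P}_3$ and $(\mathcal{P}_i)_s=-k_i\mathcal{T}$; $k_1,k_2,k_3$ are its curvature functions. Put $\mathfrak{a}_{23}=\langle(\mathcal{P}_1)_t,\mathcal{P}_2\rangle$, $\mathfrak{a}_{24}=\langle(\mathcal{P}_1)_t,\mathcal{P}_3\rangle$, $\mathfrak{a}_{34}=\langle(\mathcal{P}_2)_t,\mathcal{P}_3\rangle$,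 $P=k_3(k_2)_s-k_2(k_3)_s$, $R=k_1(k_3)_s-k_3(k_1)_s$, $S=k_2(k_1)_s-k_1(k_2)_s$ (the function $S$ is not to be confused with the surface), $Q=\sqrt{k_1^2+k_2^2+k_3^2}$, $\mathcal{W}=\sqrt{P^2+R^2+S^2}$, and $\mathcal{A}=(Pk_3-Sk_1)\mathfrak{a}_{24}+(Pk_2-Rk_1)\mathfrak{a}_{23}+(Rk_3-Sk_2)\mathfrak{a}_{34}-R(k_2)_t-S(k_3)_t-P(k_1)_t$, $\mathcal{C}=(k_1)_sP_s+(k_2)_sR_s+(k_3)_sS_s$. Standing assumptions: at least two of $k_1,k_2,k_3$ are non-zero, and $P,R,S$ are not all zero at any point. Gaussian curvature. The surface is regular, and $K=\det(A_{N_1})+\det(A_{N_2})$, where $A_{N_1},A_{N_2}$ are the shape operators of the surface with respect to an orthonormal frame $N_1,N_2$ of the normal bundle (this is the usual Gaussian curvature of the induced metric). *)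

theory Defs
  imports "HOL-Analysis.Analysis"
begin

text \<open>The ternary vector product of \<open>\<real>\<^sup>4\<close>: expanding the formal determinant with first row
  \<open>(e\<^sub>1, e\<^sub>2, e\<^sub>3, e\<^sub>4)\<close> is linear in that row, so the \<open>i\<close>-th component is the determinant with
  the \<open>i\<close>-th unit row. With this convention \<open>e\<^sub>1 \<times> e\<^sub>2 \<times> e\<^sub>3 = - e\<^sub>4\<close>.\<close>

definition tprod :: "real^4 \<Rightarrow> real^4 \<Rightarrow> real^4 \<Rightarrow> real^4" where
  "tprod x y z = (\<chi> i. det (vector [axis i 1, x, y, z] :: real^4^4))"

text \<open>Smoothness, to be used on open sets only.\<close>

primrec Ck_on :: "nat \<Rightarrow> 'a::real_normed_vector set \<Rightarrow> ('a \<Rightarrow> 'b::real_normed_vector) \<Rightarrow> bool" where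
  "Ck_on 0 U f \<longleftrightarrow> continuous_on U f"
| "Ck_on (Suc n) U f \<longleftrightarrow> (\<forall>p\<in>U. f differentiable (at p)) \<and>
     (\<forall>v. Ck_on n U (\<lambda>p. frechet_derivative f (at p) v))"

definition smooth_on :: "'a::real_normed_vector set \<Rightarrow> ('a \<Rightarrow> 'b::real_normed_vector) \<Rightarrow> bool" where
  "smooth_on U f \<longleftrightarrow> (\<forall>n. Ck_on n U f)"

text \<open>The partial derivatives of a function of \<open>(s, t)\<close>.\<close>

definition ds :: "(real \<times> real \<Rightarrow> 'a::real_normed_vector) \<Rightarrow> real \<times> real \<Rightarrow> 'a" where
  "ds f p = vector_derivative (\<lambda>s. f (s, snd p)) (at (fst p))"

definition dt :: "(real \<times> real \<Rightarrow> 'a::real_normed_vector) \<Rightarrow> real \<times> real \<Rightarrow> 'a" where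
  "dt f p = vector_derivative (\<lambda>t. f (fst p, t)) (at (snd p))"

definition regular_surface :: "(real \<times> real) set \<Rightarrow> (real \<times> real \<Rightarrow> real^4) \<Rightarrow> bool" where
  "regular_surface D \<Psi> \<longleftrightarrow> smooth_on D \<Psi> \<and> (\<forall>p\<in>D. inj (frechet_derivative \<Psi> (at p)))"

definition unit_speed_s_curves :: "(real \<times> real) set \<Rightarrow> (real \<times> real \<Rightarrow> real^4) \<Rightarrow> bool" where
  "unit_speed_s_curves D \<Psi> \<longleftrightarrow> (\<forall>p\<in>D. norm (ds \<Psi> p) = 1)"

definition betchov_da_rios :: "(real \<times> real) set \<Rightarrow> (real \<times> real \<Rightarrow> real^4) \<Rightarrow> bool" where
  "betchov_da_rios D \<Psi> \<longleftrightarrow>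
     (\<forall>p\<in>D. dt \<Psi> p = tprod (ds \<Psi> p) (ds (ds \<Psi>) p) (ds (ds (ds \<Psi>)) p))"

definition pos_orthonormal_frame :: "real^4 \<Rightarrow> real^4 \<Rightarrow> real^4 \<Rightarrow> real^4 \<Rightarrow> bool" where
  "pos_orthonormal_frame e1 e2 e3 e4 \<longleftrightarrow>
     (let F = vector [e1, e2, e3, e4] :: real^4^4
      in (\<forall>i j. F $ i \<bullet> F $ j = (if i = j then 1 else 0)) \<and> det F > 0)"

definition parallel_transport_frame ::
  "(real \<times> real) set \<Rightarrow> (real \<times> real \<Rightarrow> real^4) \<Rightarrow> (real \<times> real \<Rightarrow> real^4) \<Rightarrow>
   (real \<times> real \<Rightarrow> real^4) \<Rightarrow> (real \<times> real \<Rightarrow> real^4) \<Rightarrow> (real \<times> real \<Rightarrow> real^4) \<Rightarrow>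
   (real \<times> real \<Rightarrow> real) \<Rightarrow> (real \<times> real \<Rightarrow> real) \<Rightarrow> (real \<times> real \<Rightarrow> real) \<Rightarrow> bool" where
  "parallel_transport_frame D \<Psi> T P1 P2 P3 k1 k2 k3 \<longleftrightarrow>
     smooth_on D T \<and> smooth_on D P1 \<and> smooth_on D P2 \<and> smooth_on D P3 \<and>
     (\<forall>p\<in>D. pos_orthonormal_frame (T p) (P1 p) (P2 p) (P3 p) \<and>
        T p = ds \<Psi> p \<and>
        ds T p = k1 p *\<^sub>R P1 p + k2 p *\<^sub>R P2 p + k3 p *\<^sub>R P3 p \<and>
        ds P1 p = - k1 p *\<^sub>R T p \<and>
        ds P2 p = - k2 p *\<^sub>R T p \<and>
        ds P3 p = - k3 p *\<^sub>R T p)"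

definition orthonormal_normal_frame ::
  "(real \<times> real) set \<Rightarrow> (real \<times> real \<Rightarrow> real^4) \<Rightarrow> (real \<times> real \<Rightarrow> real^4) \<Rightarrow>
   (real \<times> real \<Rightarrow> real^4) \<Rightarrow> bool" where
  "orthonormal_normal_frame D \<Psi> N1 N2 \<longleftrightarrow>
     smooth_on D N1 \<and> smooth_on D N2 \<and>
     (\<forall>p\<in>D. norm (N1 p) = 1 \<and> norm (N2 p) = 1 \<and> N1 p \<bullet> N2 p = 0 \<and>
        N1 p \<bullet> ds \<Psi> p = 0 \<and> N1 p \<bullet> dt \<Psi> p = 0 \<and>
        N2 p \<bullet> ds \<Psi> p = 0 \<and> N2 p \<bullet> dt \<Psi> p = 0)"

definition orth_proj :: "'a::euclidean_space set \<Rightarrow> 'a \<Rightarrow> 'a" where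
  "orth_proj V x = (THE y. y \<in> V \<and> (\<forall>v\<in>V. orthogonal (x - y) v))"

definition tangent_plane :: "(real \<times> real \<Rightarrow> real^4) \<Rightarrow> real \<times> real \<Rightarrow> (real^4) set" where
  "tangent_plane \<Psi> p = span {ds \<Psi> p, dt \<Psi> p}"

text \<open>\<open>A\<^sub>N X\<close> is minus the tangential part of the derivative of \<open>N\<close> along \<open>X\<close>. As \<open>N\<close> is given on
  the parameter domain, \<open>X\<close> is first pulled back along the (injective) differential of \<open>\<Psi>\<close>; so
  the value is meaningful for \<open>X\<close> in the tangent plane at a regular point.\<close>

definition shape_operator ::
  "(real \<times> real \<Rightarrow> real^4) \<Rightarrow> (real \<times> real \<Rightarrow> real^4) \<Rightarrow> real \<times> real \<Rightarrow> real^4 \<Rightarrow> real^4" where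
  "shape_operator \<Psi> N p X =
     - orth_proj (tangent_plane \<Psi> p)
         (frechet_derivative N (at p) (THE w. frechet_derivative \<Psi> (at p) w = X))"

text \<open>The determinant of an endomorphism \<open>L\<close> of the subspace with basis \<open>b\<close>, i.e. of its matrix
  with respect to \<open>b\<close>.\<close>

definition endo_det :: "('a::real_vector)^'n \<Rightarrow> ('a \<Rightarrow> 'a) \<Rightarrow> real" where
  "endo_det b L = det (\<chi> i j. representation (range (($) b)) (L (b $ j)) (b $ i))"

definition gaussian_curvature ::
  "(real \<times> real \<Rightarrow> real^4) \<Rightarrow> (real \<times> real \<Rightarrow> real^4) \<Rightarrow> (real \<times> real \<Rightarrow> real^4) \<Rightarrow>
   real \<times> real \<Rightarrow> real" where
  "gaussian_curvature \<Psi> N1 N2 p =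
     (let b = vector [ds \<Psi> p, dt \<Psi> p] :: (real^4)^2
      in endo_det b (shape_operator \<Psi> N1 p) + endo_det b (shape_operator \<Psi> N2 p))"

definition coeff_P ::
  "(real \<times> real \<Rightarrow> real) \<Rightarrow> (real \<times> real \<Rightarrow> real) \<Rightarrow> (real \<times> real \<Rightarrow> real) \<Rightarrow>
   real \<times> real \<Rightarrow> real" where
  "coeff_P k1 k2 k3 p = k3 p * ds k2 p - k2 p * ds k3 p"

definition coeff_R ::
  "(real \<times> real \<Rightarrow> real) \<Rightarrow> (real \<times> real \<Rightarrow> real) \<Rightarrow> (real \<times> real \<Rightarrow> real) \<Rightarrow>
   real \<times> real \<Rightarrow> real" where
  "coeff_R k1 k2 k3 p = k1 p * ds k3 p - k3 p * ds k1 p"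

definition coeff_S ::
  "(real \<times> real \<Rightarrow> real) \<Rightarrow> (real \<times> real \<Rightarrow> real) \<Rightarrow> (real \<times> real \<Rightarrow> real) \<Rightarrow>
   real \<times> real \<Rightarrow> real" where
  "coeff_S k1 k2 k3 p = k2 p * ds k1 p - k1 p * ds k2 p"

definition coeff_Q ::
  "(real \<times> real \<Rightarrow> real) \<Rightarrow> (real \<times> real \<Rightarrow> real) \<Rightarrow> (real \<times> real \<Rightarrow> real) \<Rightarrow>
   real \<times> real \<Rightarrow> real" where
  "coeff_Q k1 k2 k3 p = sqrt ((k1 p)\<^sup>2 + (k2 p)\<^sup>2 + (k3 p)\<^sup>2)"

definition coeff_W ::
  "(real \<times> real \<Rightarrow> real) \<Rightarrow> (real \<times> real \<Rightarrow> real) \<Rightarrow> (real \<times> real \<Rightarrow> real) \<Rightarrow>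
   real \<times> real \<Rightarrow> real" where
  "coeff_W k1 k2 k3 p = sqrt ((coeff_P k1 k2 k3 p)\<^sup>2 + (coeff_R k1 k2 k3 p)\<^sup>2 + (coeff_S k1 k2 k3 p)\<^sup>2)"

definition coeff_C ::
  "(real \<times> real \<Rightarrow> real) \<Rightarrow> (real \<times> real \<Rightarrow> real) \<Rightarrow> (real \<times> real \<Rightarrow> real) \<Rightarrow>
   real \<times> real \<Rightarrow> real" where
  "coeff_C k1 k2 k3 p = ds k1 p * ds (coeff_P k1 k2 k3) p + ds k2 p * ds (coeff_R k1 k2 k3) p + ds k3 p * ds (coeff_S k1 k2 k3) p"

definition coeff_A ::
  "(real \<times> real \<Rightarrow> real) \<Rightarrow> (real \<times> real \<Rightarrow> real) \<Rightarrow> (real \<times> real \<Rightarrow> real) \<Rightarrow>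
   (real \<times> real \<Rightarrow> real^4) \<Rightarrow> (real \<times> real \<Rightarrow> real^4) \<Rightarrow> (real \<times> real \<Rightarrow> real^4) \<Rightarrow>
   real \<times> real \<Rightarrow> real" where
  "coeff_A k1 k2 k3 P1 P2 P3 p =
     (let a23 = dt P1 p \<bullet> P2 p; a24 = dt P1 p \<bullet> P3 p; a34 = dt P2 p \<bullet> P3 p;
          P = coeff_P k1 k2 k3 p; R = coeff_R k1 k2 k3 p; S = coeff_S k1 k2 k3 p
      in (P * k3 p - S * k1 p) * a24 + (P * k2 p - R * k1 p) * a23 + (R * k3 p - S * k2 p) * a34
           - R * dt k2 p - S * dt k3 p - P * dt k1 p)"

end

theory Submission
  imports Defs
begin

text \<open>In the frame \<open>(T, P\<^sub>1, P\<^sub>2, P\<^sub>3)\<close> the equation reads \<open>\<Psi>\<^sub>t = P P\<^sub>1 + R P\<^sub>2 + S P\<^sub>3\<close>, where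
  \<open>(P, R, S)\<close> is minus the cross product of \<open>k\<close> and \<open>k\<^sub>s\<close>. Hence \<open>\<Psi>\<^sub>s\<close> and \<open>\<Psi>\<^sub>t\<close> are orthogonal
  with lengths \<open>1\<close> and \<open>\<W>\<close>, and both \<open>\<Psi>\<^sub>s\<^sub>t\<close> and \<open>\<Psi>\<^sub>s\<^sub>s = \<Sum>k\<^sub>i P\<^sub>i\<close> are orthogonal to \<open>\<Psi>\<^sub>s\<close>, the
  latter also to \<open>\<Psi>\<^sub>t\<close>. Summing the two determinants over the normal frame gives \<open>K \<W>\<^sup>2 = \<langle>\<Psi>\<^sub>s\<^sub>s,
  \<Psi>\<^sub>t\<^sub>t\<rangle> - (\<bar>\<Psi>\<^sub>s\<^sub>t\<bar>\<^sup>2 - \<langle>\<Psi>\<^sub>s\<^sub>t, \<Psi>\<^sub>t\<rangle>\<^sup>2 / \<W>\<^sup>2)\<close>. The first term is \<open>\<A>\<close>, by differentiating \<open>\<langle>\<Psi>\<^sub>s\<^sub>s,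
  \<Psi>\<^sub>t\<rangle> = 0\<close> in \<open>t\<close>; the second is \<open>Q\<^sup>2 \<C>\<^sup>2 / \<W>\<^sup>2\<close>, by the Lagrange identity, because \<open>\<Psi>\<^sub>s\<^sub>t\<close> is
  orthogonal to \<open>\<Psi>\<^sub>s\<^sub>s\<close>.\<close>

section \<open>Partial derivatives\<close>

text \<open>\<open>ds f\<close> and \<open>dt f\<close> agree with values of the Frechet derivative
  on the domain only, so smoothness must be transferred along equality on an open set. Openness
  makes the derivatives agree there too, which feeds the induction.\<close>

lemma Ck_on_cong:
  assumes "open U" and "\<And>p. p \<in> U \<Longrightarrow> f p = g p"
  shows "Ck_on n U f \<longleftrightarrow> Ck_on n U g"
  using assms(2)
proof (induction n arbitrary: f g)
  case 0
  then show ?case by (simp cong: continuous_on_cong)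
next
  case (Suc n)
  have hd: "(f has_derivative f') (at p) \<longleftrightarrow> (g has_derivative f') (at p)" if "p \<in> U" for p f'
    using has_derivative_transform_within_open[OF _ \<open>open U\<close> that, of f f' UNIV g]
      has_derivative_transform_within_open[OF _ \<open>open U\<close> that, of g f' UNIV f] Suc.prems
    by auto
  have "frechet_derivative f (at p) = frechet_derivative g (at p)" if "p \<in> U" for p
    using hd[OF that] by (simp add: frechet_derivative_def)
  then show ?case
    using Suc.IH[of "\<lambda>p. frechet_derivative f (at p) v" "\<lambda>p. frechet_derivative g (at p) v" for v] hd
    by (simp add: differentiable_def)
qed

lemma smooth_on_differentiable: "smooth_on U f \<Longrightarrow> p \<in> U \<Longrightarrow> f differentiable (at p)"
  by (auto simp: smooth_on_def dest: spec[of _ "Suc 0"])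

lemma smooth_on_continuous: "smooth_on U f \<Longrightarrow> continuous_on U f"
  by (auto simp: smooth_on_def dest: spec[of _ 0])

lemma smooth_on_frechet: "smooth_on U f \<Longrightarrow> smooth_on U (\<lambda>p. frechet_derivative f (at p) v)"
  unfolding smooth_on_def using Ck_on.simps(2)[of _ U f] by blast

text \<open>The chain rule along the two coordinate lines through \<open>(s, t)\<close>. It links
  the partial derivatives to the Frechet derivative, in which smoothness, regularity and shape
  operators are expressed.\<close>

lemma
  assumes "f differentiable (at (s, t))"
  shows ds_has_vector_derivative: "((\<lambda>s. f (s, t)) has_vector_derivative ds f (s, t)) (at s)"
    and dt_has_vector_derivative: "((\<lambda>t. f (s, t)) has_vector_derivative dt f (s, t)) (at t)"
    and ds_eq_frechet: "ds f (s, t) = frechet_derivative f (at (s, t)) (1, 0)"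
    and dt_eq_frechet: "dt f (s, t) = frechet_derivative f (at (s, t)) (0, 1)"
proof -
  let ?f' = "frechet_derivative f (at (s, t))"
  have f': "(f has_derivative ?f') (at (s, t))"
    using assms by (simp add: frechet_derivative_works)
  interpret f': bounded_linear ?f' by (rule has_derivative_bounded_linear[OF f'])
  have lin: "?f' (h, 0) = h *\<^sub>R ?f' (1, 0)" "?f' (0, h) = h *\<^sub>R ?f' (0, 1)" for h
    unfolding f'.scaleR[symmetric] by simp_all
  have "((\<lambda>s. (s, t)) has_derivative (\<lambda>h. (h, 0))) (at s)"
    "((\<lambda>t. (s, t)) has_derivative (\<lambda>h. (0, h))) (at t)"
    by (auto intro!: derivative_eq_intros)
  from this[THEN has_derivative_compose, OF f']
  have 1: "((\<lambda>s. f (s, t)) has_vector_derivative ?f' (1, 0)) (at s)"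
    and 2: "((\<lambda>t. f (s, t)) has_vector_derivative ?f' (0, 1)) (at t)"
    unfolding has_vector_derivative_def lin[symmetric] .
  show "ds f (s, t) = ?f' (1, 0)" "dt f (s, t) = ?f' (0, 1)"
    using vector_derivative_at[OF 1] vector_derivative_at[OF 2] by (simp_all add: ds_def dt_def)
  with 1 2 show "((\<lambda>s. f (s, t)) has_vector_derivative ds f (s, t)) (at s)"
    "((\<lambda>t. f (s, t)) has_vector_derivative dt f (s, t)) (at t)" by simp_all
qed

lemma
  assumes "open U" "smooth_on U f"
  shows smooth_on_ds: "smooth_on U (ds f)" and smooth_on_dt: "smooth_on U (dt f)"
proof -
  have "ds f p = frechet_derivative f (at p) (1, 0)" "dt f p = frechet_derivative f (at p) (0, 1)"
    if "p \<in> U" for p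
    using smooth_on_differentiable[OF assms(2) that] ds_eq_frechet[of f "fst p" "snd p"]
      dt_eq_frechet[of f "fst p" "snd p"] by simp_all
  then show "smooth_on U (ds f)" "smooth_on U (dt f)"
    using smooth_on_frechet[OF assms(2)] Ck_on_cong[OF assms(1), of "ds f"] Ck_on_cong[OF assms(1), of "dt f"]
    unfolding smooth_on_def by metis+
qed

lemma
  assumes "open U" "p \<in> U" and eq: "\<And>q. q \<in> U \<Longrightarrow> f q = g q"
  shows ds_cong: "ds f p = ds g p" and dt_cong: "dt f p = dt g p"
proof -
  obtain s t where p: "p = (s, t)" by fastforce
  have ev: "\<forall>\<^sub>F q in nhds p. f q = g q"
    using assms by (auto simp: eventually_nhds)
  have "filterlim (\<lambda>s. (s, t)) (nhds p) (nhds s)" "filterlim (\<lambda>t. (s, t)) (nhds p) (nhds t)"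
    unfolding p by (intro tendsto_intros filterlim_ident)+
  from this[THEN eventually_compose_filterlim[OF ev]]
  have "\<forall>\<^sub>F x in nhds s. f (x, t) = g (x, t)" "\<forall>\<^sub>F x in nhds t. f (s, x) = g (s, x)" .
  then show "ds f p = ds g p" "dt f p = dt g p"
    unfolding ds_def dt_def p
    by (simp_all add: vector_derivative_cong_eq)
qed

lemma
  fixes f g :: "real \<times> real \<Rightarrow> 'a::real_inner"
  assumes f: "f differentiable (at p)" and g: "g differentiable (at p)"
  shows ds_inner: "ds (\<lambda>q. f q \<bullet> g q) p = ds f p \<bullet> g p + f p \<bullet> ds g p"
    and dt_inner: "dt (\<lambda>q. f q \<bullet> g q) p = dt f p \<bullet> g p + f p \<bullet> dt g p"
proof -
  obtain s t where p: "p = (s, t)" by fastforce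
  note d = f[unfolded p] g[unfolded p]
  show "ds (\<lambda>q. f q \<bullet> g q) p = ds f p \<bullet> g p + f p \<bullet> ds g p"
    using bounded_bilinear.has_vector_derivative[OF bounded_bilinear_inner
        ds_has_vector_derivative[OF d(1)] ds_has_vector_derivative[OF d(2)]]
    unfolding p by (subst ds_def) (auto intro!: vector_derivative_at simp: algebra_simps)
  show "dt (\<lambda>q. f q \<bullet> g q) p = dt f p \<bullet> g p + f p \<bullet> dt g p"
    using bounded_bilinear.has_vector_derivative[OF bounded_bilinear_inner
        dt_has_vector_derivative[OF d(1)] dt_has_vector_derivative[OF d(2)]]
    unfolding p by (subst dt_def) (auto intro!: vector_derivative_at simp: algebra_simps)
qed

text \<open>The product rule for a constant inner product: it moves a derivative from one factor to
  the other. All orthogonality relations of the frames are differentiated this way.\<close>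

lemma
  fixes f g :: "real \<times> real \<Rightarrow> 'a::real_inner"
  assumes "open U" "p \<in> U" "smooth_on U f" "smooth_on U g"
    and const: "\<And>q. q \<in> U \<Longrightarrow> f q \<bullet> g q = c"
  shows ds_inner_const: "ds f p \<bullet> g p = - (f p \<bullet> ds g p)"
    and dt_inner_const: "dt f p \<bullet> g p = - (f p \<bullet> dt g p)"
proof -
  note d = smooth_on_differentiable[OF assms(3,2)] smooth_on_differentiable[OF assms(4,2)]
  have "ds (\<lambda>q. c) p = 0" "dt (\<lambda>q. c) p = 0"
    by (simp_all add: ds_def dt_def)
  with ds_inner[OF d] dt_inner[OF d]
    ds_cong[OF assms(1,2), of "\<lambda>q. f q \<bullet> g q" "\<lambda>q. c"] dt_cong[OF assms(1,2), of "\<lambda>q. f q \<bullet> g q" "\<lambda>q. c"]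
  show "ds f p \<bullet> g p = - (f p \<bullet> ds g p)" "dt f p \<bullet> g p = - (f p \<bullet> dt g p)"
    using const by simp_all
qed

text \<open>Two uses of the mean value theorem: in \<open>s\<close> for the difference of
  \<open>f\<close> at heights \<open>b+h\<close> and \<open>b\<close>, then in \<open>t\<close> for
  \<open>fs\<close>.\<close>

lemma second_difference_mvt:
  fixes f fs fst :: "real \<Rightarrow> real \<Rightarrow> real"
  assumes "h > 0"
    and fs: "\<And>s t. s \<in> {a..a+h} \<Longrightarrow> t \<in> {b..b+h} \<Longrightarrow> ((\<lambda>s. f s t) has_real_derivative fs s t) (at s)"
    and fst: "\<And>s t. s \<in> {a..a+h} \<Longrightarrow> t \<in> {b..b+h} \<Longrightarrow> ((\<lambda>t. fs s t) has_real_derivative fst s t) (at t)"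
  obtains s t where "s \<in> {a..a+h}" "t \<in> {b..b+h}"
    "f (a+h) (b+h) - f (a+h) b - f a (b+h) + f a b = h * h * fst s t"
proof -
  have "\<exists>s>a. s < a + h \<and> (f (a+h) (b+h) - f (a+h) b) - (f a (b+h) - f a b)
      = ((a+h) - a) * (fs s (b+h) - fs s b)"
    using \<open>h > 0\<close> by (intro MVT2) (auto intro!: DERIV_diff fs)
  then obtain s where s: "a < s" "s < a + h"
    "(f (a+h) (b+h) - f (a+h) b) - (f a (b+h) - f a b) = h * (fs s (b+h) - fs s b)"
    by auto
  have "\<exists>t>b. t < b + h \<and> fs s (b+h) - fs s b = ((b+h) - b) * fst s t"
    using \<open>h > 0\<close> s by (intro MVT2) (auto intro!: fst)
  then obtain t where "b < t" "t < b + h" "fs s (b+h) - fs s b = h * fst s t"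
    by auto
  with s show ?thesis
    by (intro that[of s t]) (auto simp: algebra_simps)
qed

text \<open>Schwarz's theorem: one second difference over a small square equals \<open>h * h\<close>
  times a value of \<open>fst\<close> and also \<open>h * h\<close> times a value of
  \<open>fts\<close>, and by continuity both values are close to those at
  \<open>(a, b)\<close>.\<close>

lemma mixed_partials_real:
  fixes f fs ft fst fts :: "real \<Rightarrow> real \<Rightarrow> real"
  assumes U: "open U" "(a, b) \<in> U"
    and fs: "\<And>s t. (s, t) \<in> U \<Longrightarrow> ((\<lambda>s. f s t) has_real_derivative fs s t) (at s)"
    and ft: "\<And>s t. (s, t) \<in> U \<Longrightarrow> ((\<lambda>t. f s t) has_real_derivative ft s t) (at t)"
    and fst: "\<And>s t. (s, t) \<in> U \<Longrightarrow> ((\<lambda>t. fs s t) has_real_derivative fst s t) (at t)"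
    and fts: "\<And>s t. (s, t) \<in> U \<Longrightarrow> ((\<lambda>s. ft s t) has_real_derivative fts s t) (at s)"
    and cont: "continuous_on U (\<lambda>(s, t). fst s t)" "continuous_on U (\<lambda>(s, t). fts s t)"
  shows "fst a b = fts a b"
proof (rule ccontr)
  assume ne: "fst a b \<noteq> fts a b"
  \<comment> \<open>Half the gap, so that the \<open>e\<close>-neighbourhoods of the two values are
    disjoint.\<close>
  define e where "e = \<bar>fst a b - fts a b\<bar> / 2"
  have "e > 0" using ne by (simp add: e_def)
  have "isCont (\<lambda>(s, t). fst s t) (a, b)" "isCont (\<lambda>(s, t). fts s t) (a, b)"
    using cont U by (simp_all add: continuous_on_eq_continuous_at)
  then have "((\<lambda>(s, t). fst s t) \<longlongrightarrow> fst a b) (nhds (a, b))"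
    "((\<lambda>(s, t). fts s t) \<longlongrightarrow> fts a b) (nhds (a, b))"
    unfolding isCont_def tendsto_at_iff_tendsto_nhds by simp_all
  from this[THEN tendstoD, OF \<open>e > 0\<close>]
  have "\<forall>\<^sub>F q in nhds (a, b). dist (case q of (s, t) \<Rightarrow> fst s t) (fst a b) < e"
    "\<forall>\<^sub>F q in nhds (a, b). dist (case q of (s, t) \<Rightarrow> fts s t) (fts a b) < e" .
  moreover have "\<forall>\<^sub>F q in nhds (a, b). q \<in> U"
    using U by (rule eventually_nhds_in_open)
  ultimately have "\<forall>\<^sub>F q in nhds (a, b). q \<in> U \<and> dist (case q of (s, t) \<Rightarrow> fst s t) (fst a b) < e
      \<and> dist (case q of (s, t) \<Rightarrow> fts s t) (fts a b) < e"
    by eventually_elim simp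
  then obtain d where "d > 0" and d: "\<And>s t. dist (s, t) (a, b) < d \<Longrightarrow> (s, t) \<in> U \<and>
      dist (fst s t) (fst a b) < e \<and> dist (fts s t) (fts a b) < e"
    unfolding eventually_nhds_metric by fastforce
  \<comment> \<open>The two coordinate distances in the square add up to at most
    \<open>2 * d / 3\<close>, which is below \<open>d\<close>.\<close>
  define h where "h = d / 3"
  have "h > 0" using \<open>d > 0\<close> by (simp add: h_def)
  have near: "dist (s, t) (a, b) < d" if "s \<in> {a..a+h}" "t \<in> {b..b+h}" for s t
  proof -
    have "dist (s, t) (a, b) \<le> \<bar>s - a\<bar> + \<bar>t - b\<bar>"
      unfolding dist_Pair_Pair dist_real_def by (rule sqrt_sum_squares_le_sum_abs[THEN order_trans]) simp
    also have "\<dots> < d" using that \<open>d > 0\<close> by (auto simp: h_def)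
    finally show ?thesis .
  qed
  obtain s t where st: "s \<in> {a..a+h}" "t \<in> {b..b+h}"
    "f (a+h) (b+h) - f (a+h) b - f a (b+h) + f a b = h * h * fst s t"
    by (rule second_difference_mvt[of h a b f fs fst]) (use \<open>h > 0\<close> near d fs fst in auto)
  \<comment> \<open>The second difference is symmetric in the two variables, so the same lemma
    applies with their roles exchanged.\<close>
  obtain t' s' where st': "t' \<in> {b..b+h}" "s' \<in> {a..a+h}"
    "f (a+h) (b+h) - f a (b+h) - f (a+h) b + f a b = h * h * fts s' t'"
    by (rule second_difference_mvt[of h b a "\<lambda>t s. f s t" "\<lambda>t s. ft s t" "\<lambda>t s. fts s t"])
      (use \<open>h > 0\<close> near d ft fts in auto)
  have "h * h * fst s t = h * h * fts s' t'"
    using st(3) st'(3) by linarith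
  then have "fst s t = fts s' t'" using \<open>h > 0\<close> by simp
  moreover have "dist (fst s t) (fst a b) < e" "dist (fts s' t') (fts a b) < e"
    using d near st st' by blast+
  ultimately show False
    by (simp add: e_def dist_real_def abs_if field_simps split: if_splits)
qed

lemma mixed_partials:
  fixes f :: "real \<times> real \<Rightarrow> 'a::real_inner"
  assumes U: "open U" "p \<in> U" and f: "smooth_on U f"
  shows "dt (ds f) p = ds (dt f) p"
proof -
  obtain a b where p: "p = (a, b)" by fastforce
  note smooth = f smooth_on_ds[OF U(1) f] smooth_on_dt[OF U(1) f]
  note cont = smooth_on_continuous[OF smooth_on_dt[OF U(1) smooth(2)]]
    smooth_on_continuous[OF smooth_on_ds[OF U(1) smooth(3)]]
  have s: "((\<lambda>s. g (s, t) \<bullet> v) has_real_derivative ds g (s, t) \<bullet> v) (at s)"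
    and t: "((\<lambda>t. g (s, t) \<bullet> v) has_real_derivative dt g (s, t) \<bullet> v) (at t)"
    if "smooth_on U g" "(s, t) \<in> U" for g :: "real \<times> real \<Rightarrow> 'a" and v s t
    unfolding has_real_derivative_iff_has_vector_derivative
    by (intro bounded_linear.has_vector_derivative[OF bounded_linear_inner_left]
        ds_has_vector_derivative dt_has_vector_derivative smooth_on_differentiable[OF that])+
  have "dt (ds f) (a, b) \<bullet> v = ds (dt f) (a, b) \<bullet> v" for v
  proof (rule mixed_partials_real[OF U[unfolded p]])
    show "continuous_on U (\<lambda>(s, t). dt (ds f) (s, t) \<bullet> v)" "continuous_on U (\<lambda>(s, t). ds (dt f) (s, t) \<bullet> v)"
      using cont by (simp_all add: split_beta continuous_on_inner)
  qed (fact s[OF smooth(1)] t[OF smooth(1)] t[OF smooth(2)] s[OF smooth(3)])+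
  then have "dt (ds f) p \<bullet> v = ds (dt f) p \<bullet> v" for v by (simp only: p)
  then show ?thesis by (metis vector_eq_rdot)
qed

section \<open>Orthonormal frames and the ternary product\<close>

lemma vector_4 [simp]:
  "(vector [x, y, z, w] :: 'a::zero^4) $ 1 = x"
  "(vector [x, y, z, w] :: 'a^4) $ 2 = y"
  "(vector [x, y, z, w] :: 'a^4) $ 3 = z"
  "(vector [x, y, z, w] :: 'a^4) $ 4 = w"
  unfolding vector_def by simp_all

text \<open>Laplace expansion along the second row: only the minor of its first entry survives, with
  sign -1. In frame coordinates this row is the first frame vector.\<close>

lemma det_4_unit_row:
  fixes A :: "'a::comm_ring_1^4^4"
  assumes "A$2$1 = 1" "A$2$2 = 0" "A$2$3 = 0" "A$2$4 = 0"
  shows "det A =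
    - (A$1$2 * (A$3$3 * A$4$4 - A$3$4 * A$4$3)
       + A$1$3 * (A$3$4 * A$4$2 - A$3$2 * A$4$4)
       + A$1$4 * (A$3$2 * A$4$3 - A$3$3 * A$4$2))"
proof -
  have f1234: "finite {2::4, 3, 4}" "1 \<notin> {2::4, 3, 4}" by auto
  have f234: "finite {3::4, 4}" "2 \<notin> {3::4, 4}" by auto
  have f34: "finite {4::4}" "3 \<notin> {4::4}" by auto
  show ?thesis
    unfolding det_def UNIV_4
    unfolding sum_over_permutations_insert[OF f1234]
    unfolding sum_over_permutations_insert[OF f234]
    unfolding sum_over_permutations_insert[OF f34]
    unfolding permutes_sing
    by (simp add: sign_swap_id permutation_swap_id permutation_compose sign_compose sign_id swap_id_eq assms algebra_simps)
qed

lemma orthonormal_matrix_4: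
  fixes e1 e2 e3 e4 :: "real^4"
  assumes "e1 \<bullet> e1 = 1" "e2 \<bullet> e2 = 1" "e3 \<bullet> e3 = 1" "e4 \<bullet> e4 = 1"
    "e1 \<bullet> e2 = 0" "e1 \<bullet> e3 = 0" "e1 \<bullet> e4 = 0" "e2 \<bullet> e3 = 0" "e2 \<bullet> e4 = 0" "e3 \<bullet> e4 = 0"
  shows "orthogonal_matrix (vector [e1, e2, e3, e4])"
proof -
  let ?F = "vector [e1, e2, e3, e4] :: real^4^4"
  have "\<forall>i j. ?F $ i \<bullet> ?F $ j = (if i = j then 1 else 0)"
    using assms by (simp add: forall_4 inner_commute)
  \<comment> \<open>Orthonormality of the rows is orthogonality of the transpose, which then passes
    to the matrix itself.\<close>
  then have "transpose (transpose ?F) ** transpose ?F = mat 1"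
    by (simp add: matrix_matrix_mult_def transpose_def mat_def vec_eq_iff inner_vec_def)
  then show ?thesis
    by (metis orthogonal_matrix orthogonal_matrix_transpose)
qed

lemma orthogonal_matrix_parseval:
  fixes F :: "real^'n^'n"
  assumes "orthogonal_matrix F"
  shows "x \<bullet> y = (\<Sum>i\<in>UNIV. (x \<bullet> F $ i) * (y \<bullet> F $ i))"
proof -
  have "orthogonal_transformation ((*v) F)"
    using assms by (simp add: orthogonal_transformation_matrix)
  then have "x \<bullet> y = (F *v x) \<bullet> (F *v y)"
    by (simp add: orthogonal_transformation_def)
  then show ?thesis
    by (simp add: inner_vec_def matrix_vector_mult_def mult.commute)
qed

lemma parseval_4:
  fixes e1 e2 e3 e4 :: "real^4"
  assumes "e1 \<bullet> e1 = 1" "e2 \<bullet> e2 = 1" "e3 \<bullet> e3 = 1" "e4 \<bullet> e4 = 1"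
    "e1 \<bullet> e2 = 0" "e1 \<bullet> e3 = 0" "e1 \<bullet> e4 = 0" "e2 \<bullet> e3 = 0" "e2 \<bullet> e4 = 0" "e3 \<bullet> e4 = 0"
  shows "x \<bullet> y = (x \<bullet> e1) * (y \<bullet> e1) + (x \<bullet> e2) * (y \<bullet> e2) + (x \<bullet> e3) * (y \<bullet> e3) + (x \<bullet> e4) * (y \<bullet> e4)"
  using orthogonal_matrix_parseval[OF orthonormal_matrix_4[OF assms], of x y] by (simp add: sum_4)

lemma pos_orthonormal_frame_inner:
  assumes "pos_orthonormal_frame e1 e2 e3 e4"
  shows "e1 \<bullet> e1 = 1" "e2 \<bullet> e2 = 1" "e3 \<bullet> e3 = 1" "e4 \<bullet> e4 = 1"
    "e1 \<bullet> e2 = 0" "e1 \<bullet> e3 = 0" "e1 \<bullet> e4 = 0" "e2 \<bullet> e3 = 0" "e2 \<bullet> e4 = 0" "e3 \<bullet> e4 = 0"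
    "e2 \<bullet> e1 = 0" "e3 \<bullet> e1 = 0" "e4 \<bullet> e1 = 0" "e3 \<bullet> e2 = 0" "e4 \<bullet> e2 = 0" "e4 \<bullet> e3 = 0"
  using assms unfolding pos_orthonormal_frame_def by (simp_all add: Let_def forall_4)

text \<open>An orthogonal matrix has determinant 1 or -1; the orientation selects 1 and thereby
  fixes the sign in \<open>tprod_frame\<close>.\<close>

lemma det_pos_orthonormal_frame:
  assumes "pos_orthonormal_frame e1 e2 e3 e4"
  shows "det (vector [e1, e2, e3, e4]) = 1"
  using det_orthogonal_matrix[OF orthonormal_matrix_4[OF pos_orthonormal_frame_inner(1-10)[OF assms]]] assms
  by (auto simp: pos_orthonormal_frame_def Let_def)

lemma pos_orthonormal_frame_expand:
  assumes "pos_orthonormal_frame e1 e2 e3 e4"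
  shows "x = (x \<bullet> e1) *\<^sub>R e1 + (x \<bullet> e2) *\<^sub>R e2 + (x \<bullet> e3) *\<^sub>R e3 + (x \<bullet> e4) *\<^sub>R e4" (is "x = ?x")
proof -
  have "y \<bullet> x = y \<bullet> ?x" for y
    using parseval_4[OF pos_orthonormal_frame_inner(1-10)[OF assms], of y x]
    by (simp add: inner_add_right mult.commute)
  then show ?thesis by (metis vector_eq_ldot)
qed

text \<open>Multiplying by the transposed frame matrix, of determinant 1, turns the rows into frame
  coordinates, where \<open>e1\<close> becomes a unit row. Hence \<open>b1\<close> drops out, and
  what remains is minus the cross product of the other coordinates.\<close>

lemma tprod_frame:
  assumes "pos_orthonormal_frame e1 e2 e3 e4"
  shows "tprod e1 (a2 *\<^sub>R e2 + a3 *\<^sub>R e3 + a4 *\<^sub>R e4) (b1 *\<^sub>R e1 + b2 *\<^sub>R e2 + b3 *\<^sub>R e3 + b4 *\<^sub>R e4)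
    = (a4 * b3 - a3 * b4) *\<^sub>R e2 + (a2 * b4 - a4 * b2) *\<^sub>R e3 + (a3 * b2 - a2 * b3) *\<^sub>R e4"
    (is "tprod e1 ?a ?b = ?c")
proof -
  let ?F = "vector [e1, e2, e3, e4] :: real^4^4"
  note e = pos_orthonormal_frame_inner[OF assms]
  have "tprod e1 ?a ?b $ i = ?c $ i" for i
  proof -
    let ?A = "vector [axis i 1, e1, ?a, ?b] :: real^4^4"
    have coord: "(?A ** transpose ?F) $ j $ k = ?A $ j \<bullet> ?F $ k" for j k
      by (simp add: matrix_matrix_mult_def transpose_def inner_vec_def)
    have "det ?A = det (?A ** transpose ?F)"
      by (simp add: det_mul det_pos_orthonormal_frame[OF assms])
    also have "\<dots> = ?c $ i"
      by (subst det_4_unit_row; unfold coord; simp add: e inner_axis' inner_add_left inner_add_right algebra_simps)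
    finally show ?thesis by (simp add: tprod_def)
  qed
  then show ?thesis by (simp add: vec_eq_iff)
qed

section \<open>Determinants of shape operators\<close>

lemma orth_proj_span_orthogonal_pair:
  fixes u v x :: "'a::euclidean_space"
  assumes "u \<noteq> 0" "v \<noteq> 0" "u \<bullet> v = 0"
  shows "orth_proj (span {u, v}) x = (x \<bullet> u / (u \<bullet> u)) *\<^sub>R u + (x \<bullet> v / (v \<bullet> v)) *\<^sub>R v"
    (is "_ = ?y")
  unfolding orth_proj_def
proof (rule the_equality)
  have y: "?y \<in> span {u, v}"
    by (intro span_add span_scale span_base) auto
  have "orthogonal (x - ?y) w" if "w \<in> {u, v}" for w
    using that assms
    by (auto simp: orthogonal_def inner_diff_left inner_add_left inner_commute[of v u])
  then have o: "orthogonal (x - ?y) w" if "w \<in> span {u, v}" for w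
    using that orthogonal_to_span by blast
  with y show "?y \<in> span {u, v} \<and> (\<forall>w\<in>span {u, v}. orthogonal (x - ?y) w)" by blast
  fix z assume z: "z \<in> span {u, v} \<and> (\<forall>w\<in>span {u, v}. orthogonal (x - z) w)"
  \<comment> \<open>Uniqueness: the difference of two candidates lies in the plane and is orthogonal
    to it, hence to itself.\<close>
  then have "z - ?y \<in> span {u, v}" using y by (intro span_diff) auto
  then have "(x - ?y) \<bullet> (z - ?y) = 0" "(x - z) \<bullet> (z - ?y) = 0"
    using o z by (auto simp: orthogonal_def)
  then have "(z - ?y) \<bullet> (z - ?y) = 0"
    by (simp add: inner_diff_left)
  then show "z = ?y" by simp
qed

text \<open>\<open>u \<noteq> v\<close> is a separate condition because the set
  \<open>{u, v}\<close> collapses when the vectors coincide and may still be independent.\<close>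

lemma endo_det_pair:
  assumes indep: "independent {u, v}" and "u \<noteq> v"
    and L: "L u = a *\<^sub>R u + b *\<^sub>R v" "L v = c *\<^sub>R u + d *\<^sub>R v"
  shows "endo_det (vector [u, v] :: _^2) L = a * d - b * c"
proof -
  have range: "range (($) (vector [u, v] :: _^2)) = {u, v}"
    by (auto simp: UNIV_2)
  have mem: "u \<in> span {u, v}" "v \<in> span {u, v}" by (auto intro: span_base)
  have "representation {u, v} (x *\<^sub>R u + y *\<^sub>R v) u = x"
    "representation {u, v} (x *\<^sub>R u + y *\<^sub>R v) v = y" for x y
    using \<open>u \<noteq> v\<close> mem
    by (simp_all add: representation_add representation_scale representation_basis indep span_scale)
  then show ?thesis
    by (simp add: endo_det_def det_2 range L)
qed

text \<open>In an orthogonal basis the tangential projection is computed coordinate by coordinate,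
  and the minus sign of the shape operator cancels in a determinant of size two.\<close>

lemma endo_det_shape_operator:
  assumes \<Psi>: "\<Psi> differentiable (at p)" "inj (frechet_derivative \<Psi> (at p))"
    and N: "N differentiable (at p)"
    and orth: "ds \<Psi> p \<bullet> dt \<Psi> p = 0"
  shows "endo_det (vector [ds \<Psi> p, dt \<Psi> p] :: (real^4)^2) (shape_operator \<Psi> N p) =
    ((ds N p \<bullet> ds \<Psi> p) * (dt N p \<bullet> dt \<Psi> p) - (ds N p \<bullet> dt \<Psi> p) * (dt N p \<bullet> ds \<Psi> p))
      / ((ds \<Psi> p \<bullet> ds \<Psi> p) * (dt \<Psi> p \<bullet> dt \<Psi> p))"
proof -
  obtain s t where p: "p = (s, t)" by fastforce
  let ?f' = "frechet_derivative \<Psi> (at p)" and ?u = "ds \<Psi> p" and ?v = "dt \<Psi> p"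
  have uv: "?u = ?f' (1, 0)" "?v = ?f' (0, 1)"
    using ds_eq_frechet[OF \<Psi>(1)[unfolded p]] dt_eq_frechet[OF \<Psi>(1)[unfolded p]] by (simp_all add: p)
  have N': "ds N p = frechet_derivative N (at p) (1, 0)" "dt N p = frechet_derivative N (at p) (0, 1)"
    using ds_eq_frechet[OF N[unfolded p]] dt_eq_frechet[OF N[unfolded p]] by (simp_all add: p)
  have "?f' 0 = 0"
    using linear_0[OF linear_frechet_derivative[OF \<Psi>(1)]] .
  then have ne: "?u \<noteq> 0" "?v \<noteq> 0"
    using inj_eq[OF \<Psi>(2), of _ 0] by (auto simp: uv zero_prod_def)
  then have ne': "?u \<noteq> ?v" using orth by auto
  have indep: "independent {?u, ?v}"
    using ne orth by (intro pairwise_orthogonal_independent)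
      (auto simp: pairwise_def orthogonal_def inner_commute)
  \<comment> \<open>By injectivity the basis vectors pull back to \<open>(1, 0)\<close> and
    \<open>(0, 1)\<close>, so \<open>N\<close> is differentiated in \<open>s\<close> and in
    \<open>t\<close>.\<close>
  have the: "(THE w. ?f' w = ?f' z) = z" for z
    using \<Psi>(2) by (auto simp: inj_eq)
  have "shape_operator \<Psi> N p ?u = - orth_proj (span {?u, ?v}) (ds N p)"
    "shape_operator \<Psi> N p ?v = - orth_proj (span {?u, ?v}) (dt N p)"
    using the[of "(1, 0)"] the[of "(0, 1)"]
    by (simp_all add: shape_operator_def tangent_plane_def uv N')
  then have "shape_operator \<Psi> N p ?u
      = (- (ds N p \<bullet> ?u / (?u \<bullet> ?u))) *\<^sub>R ?u + (- (ds N p \<bullet> ?v / (?v \<bullet> ?v))) *\<^sub>R ?v"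
    "shape_operator \<Psi> N p ?v
      = (- (dt N p \<bullet> ?u / (?u \<bullet> ?u))) *\<^sub>R ?u + (- (dt N p \<bullet> ?v / (?v \<bullet> ?v))) *\<^sub>R ?v"
    by (simp_all add: orth_proj_span_orthogonal_pair[OF ne orth])
  from endo_det_pair[of ?u ?v "shape_operator \<Psi> N p", OF indep ne' this]
  show ?thesis using ne by (simp add: field_simps)
qed

section \<open>The Gaussian curvature of the soliton surface\<close>

text \<open>Differentiating \<open>N \<bullet> ds \<Psi> = 0\<close> and
  \<open>N \<bullet> dt \<Psi> = 0\<close> moves the derivatives off \<open>N\<close> and yields
  second fundamental form coefficients, with equal mixed terms by
  \<open>mixed_partials\<close>.\<close>

lemma gaussian_curvature_orthogonal_coordinates:
  assumes U: "open U" "p \<in> U" and reg: "regular_surface U \<Psi>"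
    and normal: "orthonormal_normal_frame U \<Psi> N1 N2"
    and orth: "ds \<Psi> p \<bullet> dt \<Psi> p = 0"
  shows "gaussian_curvature \<Psi> N1 N2 p =
    ((ds (ds \<Psi>) p \<bullet> N1 p) * (dt (dt \<Psi>) p \<bullet> N1 p) - (ds (dt \<Psi>) p \<bullet> N1 p)\<^sup>2
      + ((ds (ds \<Psi>) p \<bullet> N2 p) * (dt (dt \<Psi>) p \<bullet> N2 p) - (ds (dt \<Psi>) p \<bullet> N2 p)\<^sup>2))
      / ((ds \<Psi> p \<bullet> ds \<Psi> p) * (dt \<Psi> p \<bullet> dt \<Psi> p))"
proof -
  have \<Psi>: "smooth_on U \<Psi>" "inj (frechet_derivative \<Psi> (at p))"
    using reg U by (auto simp: regular_surface_def)
  note smooth = smooth_on_ds[OF U(1) \<Psi>(1)] smooth_on_dt[OF U(1) \<Psi>(1)]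
  have "endo_det (vector [ds \<Psi> p, dt \<Psi> p] :: (real^4)^2) (shape_operator \<Psi> N p) =
      ((ds (ds \<Psi>) p \<bullet> N p) * (dt (dt \<Psi>) p \<bullet> N p) - (ds (dt \<Psi>) p \<bullet> N p)\<^sup>2)
        / ((ds \<Psi> p \<bullet> ds \<Psi> p) * (dt \<Psi> p \<bullet> dt \<Psi> p))"
    if N: "smooth_on U N" and n: "\<And>q. q \<in> U \<Longrightarrow> N q \<bullet> ds \<Psi> q = 0" "\<And>q. q \<in> U \<Longrightarrow> N q \<bullet> dt \<Psi> q = 0" for N
    using ds_inner_const[OF U N smooth(1) n(1)] dt_inner_const[OF U N smooth(1) n(1)]
      ds_inner_const[OF U N smooth(2) n(2)] dt_inner_const[OF U N smooth(2) n(2)]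
    by (simp add: endo_det_shape_operator[OF smooth_on_differentiable[OF \<Psi>(1) U(2)] \<Psi>(2)
        smooth_on_differentiable[OF N U(2)] orth] mixed_partials[OF U \<Psi>(1)]
        power2_eq_square inner_commute[of "N p"])
  then show ?thesis
    using normal by (simp add: orthonormal_normal_frame_def gaussian_curvature_def add_divide_distrib)
qed

text \<open>Parseval for the basis \<open>u\<close>, \<open>v\<close> normalized, \<open>n1\<close>,
  \<open>n2\<close>. It removes the chosen normal frame from the curvature formula.\<close>

lemma normal_plane_inner:
  fixes u v n1 n2 :: "real^4"
  assumes "u \<bullet> u = 1" "v \<noteq> 0" "u \<bullet> v = 0" "n1 \<bullet> n1 = 1" "n2 \<bullet> n2 = 1" "n1 \<bullet> n2 = 0"
    "n1 \<bullet> u = 0" "n1 \<bullet> v = 0" "n2 \<bullet> u = 0" "n2 \<bullet> v = 0"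
  shows "(x \<bullet> n1) * (y \<bullet> n1) + (x \<bullet> n2) * (y \<bullet> n2) =
    x \<bullet> y - (x \<bullet> u) * (y \<bullet> u) - (x \<bullet> v) * (y \<bullet> v) / (v \<bullet> v)"
proof -
  have "v \<bullet> v = norm v * norm v"
    by (simp add: dot_square_norm power2_eq_square)
  with parseval_4[of u "v /\<^sub>R norm v" n1 n2 x y] assms show ?thesis
    by (simp add: inner_commute field_simps)
qed

text \<open>The Lagrange identity for \<open>m\<close> and \<open>b = l \<times> k\<close>, with the double cross product
  \<open>m \<times> b = (m \<bullet> k) l - (m \<bullet> l) k\<close> expanded.\<close>

lemma lagrange_double_cross:
  fixes k1 k2 k3 l1 l2 l3 m1 m2 m3 :: real
  assumes "b1 = k3 * l2 - k2 * l3" "b2 = k1 * l3 - k3 * l1" "b3 = k2 * l1 - k1 * l2"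
    and "m1 * k1 + m2 * k2 + m3 * k3 = 0"
  shows "(m1\<^sup>2 + m2\<^sup>2 + m3\<^sup>2) * (b1\<^sup>2 + b2\<^sup>2 + b3\<^sup>2) - (m1 * b1 + m2 * b2 + m3 * b3)\<^sup>2
    = (k1\<^sup>2 + k2\<^sup>2 + k3\<^sup>2) * (l1 * m1 + l2 * m2 + l3 * m3)\<^sup>2"
proof -
  define e where "e = m1 * k1 + m2 * k2 + m3 * k3"
  define c where "c = l1 * m1 + l2 * m2 + l3 * m3"
  have "m2 * b3 - m3 * b2 = e * l1 - c * k1" "m3 * b1 - m1 * b3 = e * l2 - c * k2"
    "m1 * b2 - m2 * b1 = e * l3 - c * k3"
    by (simp_all add: assms(1-3) e_def c_def algebra_simps)
  moreover have "e = 0" using assms(4) by (simp add: e_def)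
  ultimately have "(m2 * b3 - m3 * b2)\<^sup>2 + (m3 * b1 - m1 * b3)\<^sup>2 + (m1 * b2 - m2 * b1)\<^sup>2
      = (k1\<^sup>2 + k2\<^sup>2 + k3\<^sup>2) * c\<^sup>2"
    by (simp only: mult_zero_left diff_0 power2_minus power_mult_distrib) (simp add: algebra_simps)
  then show ?thesis
    unfolding c_def by (simp add: power2_eq_square algebra_simps)
qed

theorem gaussian_curvature_betchov_da_rios:
  assumes U: "open U" and p: "p \<in> U"
    and regular: "regular_surface U \<Psi>"
    and frame: "parallel_transport_frame U \<Psi> T P1 P2 P3 k1 k2 k3"
    and PRS_nonzero: "coeff_P k1 k2 k3 p \<noteq> 0 \<or> coeff_R k1 k2 k3 p \<noteq> 0 \<or> coeff_S k1 k2 k3 p \<noteq> 0"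
    and bdr: "betchov_da_rios U \<Psi>"
    and normal_frame: "orthonormal_normal_frame U \<Psi> N1 N2"
  shows "gaussian_curvature \<Psi> N1 N2 p =
      (coeff_A k1 k2 k3 P1 P2 P3 p * (coeff_W k1 k2 k3 p)\<^sup>2
         - (coeff_Q k1 k2 k3 p)\<^sup>2 * (coeff_C k1 k2 k3 p)\<^sup>2)
      / (coeff_W k1 k2 k3 p) ^ 4"
proof -
  let ?Z = "dt \<Psi>"
  let ?P = "coeff_P k1 k2 k3" and ?R = "coeff_R k1 k2 k3" and ?S = "coeff_S k1 k2 k3"
  have smooth_frame: "smooth_on U T" "smooth_on U P1" "smooth_on U P2" "smooth_on U P3"
    using frame by (simp_all add: parallel_transport_frame_def)
  have smooth_\<Psi>: "smooth_on U \<Psi>" using regular by (simp add: regular_surface_def)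
  note smooth_Z = smooth_on_dt[OF U smooth_\<Psi>]
  note smooth_Ts = smooth_on_ds[OF U smooth_frame(1)]
  note diff = smooth_on_differentiable
  have fr: "pos_orthonormal_frame (T q) (P1 q) (P2 q) (P3 q)" "T q = ds \<Psi> q"
    "ds T q = k1 q *\<^sub>R P1 q + k2 q *\<^sub>R P2 q + k3 q *\<^sub>R P3 q"
    "ds P1 q = - k1 q *\<^sub>R T q" "ds P2 q = - k2 q *\<^sub>R T q" "ds P3 q = - k3 q *\<^sub>R T q"
    if "q \<in> U" for q
    using frame that unfolding parallel_transport_frame_def by blast+
  note orth = pos_orthonormal_frame_inner[OF fr(1)]
  \<comment> \<open>Written as inner products of smooth fields, the curvatures can be differentiated
    by the product rule.\<close>
  have k: "k1 q = ds T q \<bullet> P1 q" "k2 q = ds T q \<bullet> P2 q" "k3 q = ds T q \<bullet> P3 q" if "q \<in> U" for q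
    by (simp_all add: fr(3)[OF that] orth[OF that] inner_add_left)
  have TsT: "ds T q \<bullet> T q = 0" if "q \<in> U" for q
    by (simp add: fr(3)[OF that] orth[OF that] inner_add_left)
  \<comment> \<open>The other product rule term vanishes: each \<open>ds Pi\<close> is a multiple of
    \<open>T\<close>, which is orthogonal to \<open>ds T\<close>.\<close>
  have ds_k: "ds k1 q = ds (ds T) q \<bullet> P1 q" "ds k2 q = ds (ds T) q \<bullet> P2 q" "ds k3 q = ds (ds T) q \<bullet> P3 q"
    if q: "q \<in> U" for q
    by (simp_all add: ds_cong[OF U q k(1)] ds_cong[OF U q k(2)] ds_cong[OF U q k(3)]
        ds_inner diff[OF smooth_Ts q] diff[OF smooth_frame(2) q] diff[OF smooth_frame(3) q]
        diff[OF smooth_frame(4) q] fr(4-6)[OF q] TsT[OF q])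
  have Z: "?Z q = ?P q *\<^sub>R P1 q + ?R q *\<^sub>R P2 q + ?S q *\<^sub>R P3 q" if q: "q \<in> U" for q
  proof -
    have 1: "ds (ds \<Psi>) r = ds T r" if "r \<in> U" for r
      using ds_cong[OF U that fr(2)] by simp
    have 2: "ds (ds (ds \<Psi>)) q = ds (ds T) q"
      using ds_cong[OF U q 1] .
    have "?Z q = tprod (T q) (ds T q) (ds (ds T) q)"
      using bdr q by (simp add: betchov_da_rios_def 1 2 fr(2))
    \<comment> \<open>The components along the \<open>Pi\<close> are the derivatives of the
      curvatures; the one along \<open>T\<close> disappears in the product with
      \<open>T\<close>.\<close>
    also have "ds (ds T) q = (ds (ds T) q \<bullet> T q) *\<^sub>R T q + ds k1 q *\<^sub>R P1 q + ds k2 q *\<^sub>R P2 q + ds k3 q *\<^sub>R P3 q"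
      unfolding ds_k[OF q] by (rule pos_orthonormal_frame_expand[OF fr(1)[OF q]])
    finally show ?thesis
      unfolding fr(3)[OF q] tprod_frame[OF fr(1)[OF q]] by (simp add: coeff_P_def coeff_R_def coeff_S_def)
  qed
  have ZT: "?Z q \<bullet> T q = 0" and PRS: "?P q = ?Z q \<bullet> P1 q" "?R q = ?Z q \<bullet> P2 q" "?S q = ?Z q \<bullet> P3 q"
    and ZTs: "?Z q \<bullet> ds T q = 0" if "q \<in> U" for q
    by (simp_all add: Z[OF that] orth[OF that] inner_add_left inner_add_right fr(3)[OF that])
      (simp add: coeff_P_def coeff_R_def coeff_S_def algebra_simps)
  let ?M = "ds ?Z p" and ?Y = "ds T p"
  note orthp = orth[OF p] and frp = fr[OF p] and dp = diff[OF _ p]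
  \<comment> \<open>Again the terms with \<open>ds Pi\<close> vanish, now because
    \<open>dt \<Psi>\<close> is orthogonal to \<open>T\<close>.\<close>
  have ds_PRS: "ds ?P p = ?M \<bullet> P1 p" "ds ?R p = ?M \<bullet> P2 p" "ds ?S p = ?M \<bullet> P3 p"
    by (simp_all add: ds_cong[OF U p PRS(1)] ds_cong[OF U p PRS(2)] ds_cong[OF U p PRS(3)]
        ds_inner dp smooth_Z smooth_frame frp(4-6) ZT[OF p])
  have M: "?M = dt T p"
    using dt_cong[OF U p fr(2)] mixed_partials[OF U p smooth_\<Psi>] by simp
  have MT: "?M \<bullet> T p = 0"
    using dt_inner_const[OF U p smooth_frame(1) smooth_frame(1) orth(1)] by (simp add: M inner_commute)
  \<comment> \<open>The \<open>s\<close>-derivative of \<open>ZTs\<close>. The right side vanishes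
    because \<open>(P, R, S)\<close> is orthogonal to the vector of the \<open>ds ki\<close>; this
    provides the orthogonality needed for \<open>lagrange_double_cross\<close>.\<close>
  have "?M \<bullet> ?Y = - (?Z p \<bullet> ds (ds T) p)"
    by (rule ds_inner_const[OF U p smooth_Z smooth_Ts ZTs])
  also have "\<dots> = 0"
    by (simp add: Z[OF p] inner_add_left inner_commute[of "P1 p"] inner_commute[of "P2 p"] inner_commute[of "P3 p"]
        flip: ds_k[OF p]) (simp add: coeff_P_def coeff_R_def coeff_S_def algebra_simps)
  finally have MY: "(?M \<bullet> P1 p) * k1 p + (?M \<bullet> P2 p) * k2 p + (?M \<bullet> P3 p) * k3 p = 0"
    by (simp add: frp(3) inner_add_right algebra_simps)
  have dt_k: "dt k1 p = dt (ds T) p \<bullet> P1 p + ?Y \<bullet> dt P1 p" "dt k2 p = dt (ds T) p \<bullet> P2 p + ?Y \<bullet> dt P2 p"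
    "dt k3 p = dt (ds T) p \<bullet> P3 p + ?Y \<bullet> dt P3 p"
    by (simp_all add: dt_cong[OF U p k(1)] dt_cong[OF U p k(2)] dt_cong[OF U p k(3)]
        dt_inner dp smooth_Ts smooth_frame)
  \<comment> \<open>Skew-symmetry of the \<open>t\<close>-derivative of the frame leaves just the
    three coefficients that occur in \<open>coeff_A\<close>.\<close>
  have dt_P: "P1 p \<bullet> dt P1 p = 0" "P2 p \<bullet> dt P2 p = 0" "P3 p \<bullet> dt P3 p = 0"
    "P1 p \<bullet> dt P2 p = - (dt P1 p \<bullet> P2 p)" "P1 p \<bullet> dt P3 p = - (dt P1 p \<bullet> P3 p)"
    "P2 p \<bullet> dt P3 p = - (dt P2 p \<bullet> P3 p)"
    using dt_inner_const[OF U p smooth_frame(2) smooth_frame(2) orth(2)]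
      dt_inner_const[OF U p smooth_frame(3) smooth_frame(3) orth(3)]
      dt_inner_const[OF U p smooth_frame(4) smooth_frame(4) orth(4)]
      dt_inner_const[OF U p smooth_frame(2) smooth_frame(3) orth(8)]
      dt_inner_const[OF U p smooth_frame(2) smooth_frame(4) orth(9)]
      dt_inner_const[OF U p smooth_frame(3) smooth_frame(4) orth(10)]
    by (simp_all add: inner_commute)
  \<comment> \<open>The \<open>t\<close>-derivative of \<open>ZTs\<close>; the components of
    \<open>dt (ds T)\<close> along the \<open>Pi\<close> are then read off from
    \<open>dt_k\<close>.\<close>
  have "?Y \<bullet> dt ?Z p = - (dt (ds T) p \<bullet> ?Z p)"
    using dt_inner_const[OF U p smooth_Z smooth_Ts ZTs] by (simp add: inner_commute)
  also have "\<dots> = - (?P p * (dt k1 p - ?Y \<bullet> dt P1 p) + ?R p * (dt k2 p - ?Y \<bullet> dt P2 p) + ?S p * (dt k3 p - ?Y \<bullet> dt P3 p))"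
    by (simp add: Z[OF p] inner_add_right dt_k)
  also have "\<dots> = coeff_A k1 k2 k3 P1 P2 P3 p"
    unfolding coeff_A_def Let_def frp(3)
    by (simp add: inner_add_left dt_P inner_commute[of "P2 p" "dt P1 p"] inner_commute[of "P3 p" "dt P1 p"]
        inner_commute[of "P3 p" "dt P2 p"] algebra_simps)
  finally have A: "?Y \<bullet> dt ?Z p = coeff_A k1 k2 k3 P1 P2 P3 p" .
  have ZZ: "?Z p \<bullet> ?Z p = (coeff_W k1 k2 k3 p)\<^sup>2"
    by (simp add: Z[OF p] inner_add_left inner_add_right orthp coeff_W_def power2_eq_square)
  have W: "(coeff_W k1 k2 k3 p)\<^sup>2 = (?P p)\<^sup>2 + (?R p)\<^sup>2 + (?S p)\<^sup>2"
    by (simp add: coeff_W_def)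
  have W0: "coeff_W k1 k2 k3 p \<noteq> 0"
    using PRS_nonzero by (auto simp: coeff_W_def add_nonneg_eq_0_iff)
  have MM: "?M \<bullet> ?M = (?M \<bullet> P1 p)\<^sup>2 + (?M \<bullet> P2 p)\<^sup>2 + (?M \<bullet> P3 p)\<^sup>2"
    using parseval_4[OF orthp(1-10), of ?M ?M] by (simp add: MT power2_eq_square)
  have MZ: "?M \<bullet> ?Z p = (?M \<bullet> P1 p) * ?P p + (?M \<bullet> P2 p) * ?R p + (?M \<bullet> P3 p) * ?S p"
    by (simp add: Z[OF p] inner_add_right algebra_simps)
  \<comment> \<open>Here \<open>l\<close> is the vector of the \<open>ds ki\<close>,
    \<open>m\<close> holds the components of \<open>?M\<close> along the \<open>Pi\<close>, and
    \<open>b\<close> is \<open>(P, R, S)\<close>; by \<open>ds_PRS\<close> the product of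
    \<open>l\<close> and \<open>m\<close> is \<open>coeff_C\<close>.\<close>
  have C: "(?M \<bullet> ?M) * (coeff_W k1 k2 k3 p)\<^sup>2 - (?M \<bullet> ?Z p)\<^sup>2 = (coeff_Q k1 k2 k3 p)\<^sup>2 * (coeff_C k1 k2 k3 p)\<^sup>2"
    using lagrange_double_cross[OF coeff_P_def[of k1 k2 k3 p] coeff_R_def[of k1 k2 k3 p]
        coeff_S_def[of k1 k2 k3 p] MY]
    by (simp add: MM MZ W coeff_Q_def coeff_C_def ds_PRS)
  have n: "N1 p \<bullet> N1 p = 1" "N2 p \<bullet> N2 p = 1" "N1 p \<bullet> N2 p = 0" "N1 p \<bullet> T p = 0" "N1 p \<bullet> ?Z p = 0"
    "N2 p \<bullet> T p = 0" "N2 p \<bullet> ?Z p = 0"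
    using normal_frame p by (simp_all add: orthonormal_normal_frame_def frp(2) dot_square_norm)
  have Z0: "?Z p \<noteq> 0" using ZZ W0 by auto
  have TZ: "T p \<bullet> ?Z p = 0" using ZT[OF p] by (simp add: inner_commute)
  note N = normal_plane_inner[OF orthp(1) Z0 TZ n]
  have "gaussian_curvature \<Psi> N1 N2 p =
    (((?Y \<bullet> N1 p) * (dt ?Z p \<bullet> N1 p) + (?Y \<bullet> N2 p) * (dt ?Z p \<bullet> N2 p))
      - ((?M \<bullet> N1 p) * (?M \<bullet> N1 p) + (?M \<bullet> N2 p) * (?M \<bullet> N2 p))) / (?Z p \<bullet> ?Z p)"
    using gaussian_curvature_orthogonal_coordinates[OF U p regular normal_frame] TZ orthp(1)
      ds_cong[OF U p fr(2)] by (simp add: frp(2) power2_eq_square algebra_simps)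
  \<comment> \<open>\<open>N\<close> is applied to the pairs \<open>?Y\<close>,
    \<open>dt ?Z p\<close> and \<open>?M\<close>, \<open>?M\<close>. The first pair has no
    tangential correction, since \<open>?Y\<close> is normal to the surface; the second keeps only
    the one along \<open>?Z p\<close>.\<close>
  also have "\<dots> = (coeff_A k1 k2 k3 P1 P2 P3 p - (?M \<bullet> ?M - (?M \<bullet> ?Z p)\<^sup>2 / (?Z p \<bullet> ?Z p))) / (?Z p \<bullet> ?Z p)"
    unfolding N by (simp add: A MT TsT[OF p] ZTs[OF p] inner_commute[of ?Y "?Z p"] power2_eq_square)
  also have "\<dots> = (coeff_A k1 k2 k3 P1 P2 P3 p * (coeff_W k1 k2 k3 p)\<^sup>2
      - ((?M \<bullet> ?M) * (coeff_W k1 k2 k3 p)\<^sup>2 - (?M \<bullet> ?Z p)\<^sup>2)) / (coeff_W k1 k2 k3 p) ^ 4"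
    using W0 by (simp add: ZZ field_simps power4_eq_xxxx power2_eq_square)
  finally show "gaussian_curvature \<Psi> N1 N2 p =
      (coeff_A k1 k2 k3 P1 P2 P3 p * (coeff_W k1 k2 k3 p)\<^sup>2
         - (coeff_Q k1 k2 k3 p)\<^sup>2 * (coeff_C k1 k2 k3 p)\<^sup>2)
      / (coeff_W k1 k2 k3 p) ^ 4"
    unfolding C .
qed

theorem theorem3:
  fixes I J :: "real set"
    and \<Psi> T P1 P2 P3 N1 N2 :: "real \<times> real \<Rightarrow> real^4"
    and k1 k2 k3 :: "real \<times> real \<Rightarrow> real"
  assumes intervals: "open I" "is_interval I" "open J" "is_interval J"
    and regular: "regular_surface (I \<times> J) \<Psi>"
    and unit_speed: "unit_speed_s_curves (I \<times> J) \<Psi>"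
    and frame: "parallel_transport_frame (I \<times> J) \<Psi> T P1 P2 P3 k1 k2 k3"
    and two_nonzero:
      "(\<exists>p\<in>I \<times> J. k1 p \<noteq> 0) \<and> (\<exists>p\<in>I \<times> J. k2 p \<noteq> 0) \<or>
       (\<exists>p\<in>I \<times> J. k1 p \<noteq> 0) \<and> (\<exists>p\<in>I \<times> J. k3 p \<noteq> 0) \<or>
       (\<exists>p\<in>I \<times> J. k2 p \<noteq> 0) \<and> (\<exists>p\<in>I \<times> J. k3 p \<noteq> 0)"
    and PRS_nonzero:
      "\<forall>p\<in>I \<times> J.
         coeff_P k1 k2 k3 p \<noteq> 0 \<or> coeff_R k1 k2 k3 p \<noteq> 0 \<or> coeff_S k1 k2 k3 p \<noteq> 0"
    and bdr: "betchov_da_rios (I \<times> J) \<Psi>"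
    and normal_frame: "orthonormal_normal_frame (I \<times> J) \<Psi> N1 N2"
  shows "\<forall>p\<in>I \<times> J.
    gaussian_curvature \<Psi> N1 N2 p =
      (coeff_A k1 k2 k3 P1 P2 P3 p * (coeff_W k1 k2 k3 p)\<^sup>2
         - (coeff_Q k1 k2 k3 p)\<^sup>2 * (coeff_C k1 k2 k3 p)\<^sup>2)
      / (coeff_W k1 k2 k3 p) ^ 4"
  using gaussian_curvature_betchov_da_rios[OF open_Times[OF intervals(1,3)] _ regular frame _ bdr normal_frame]
    PRS_nonzero by blast

end
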